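(* A $2$-edge-coloured graph $G=(\Gamma,R,B)$ is chromatically invariant if and only if for every pair of disjoint non-empty independent sets $I_1,I_2$ of $\Gamma$, the $2$-edge-coloured subgraph of $G$ induced by $I_1\cup I_2$ is monochromatic.
   Context: All graphs are finite and simple. A $2$-edge-coloured graph is a triple $G=(\Gamma,R,B)$ with $R,B\subseteq E(\Gamma)$, $R\cap B=\emptyset$, $R\cup B=E(\Gamma)$ (red and blue edges). It is monochromatic if $R=\emptyset$ or $B=\emptyset$; induced subgraphs inherit the colours of their edges. A $k$-colouring of $G$ is a proper vertex colouring $c:V(\Gamma)\to\{1,\dots,k\}$ of $\Gamma$ such that for every $ux\in R$ and $vy\in B$ (either endpoint may play the role of $u$, resp. $v$), $c(u)=c(v)$ implies $c(x)\ne c(y)$. $P(G,\lambda)$ is the polynomial whose value at each non-negative integer $k$ is the number of $k$-colourings of $G$. $G$ is chromatically invariant if $P(G,\lambda)=P(\Gamma,\lambda)$, the usual chromatic polynomial of $\Gamma$. *)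

theory Defs
  imports "HOL-Computational_Algebra.Polynomial" "HOL-Library.FuncSet"
begin

section \<open>Graphs and 2-edge-coloured graphs\<close>

record 'a graph =
  verts :: "'a set"
  edges :: "'a set set"

definition simple_graph :: "'a graph \<Rightarrow> bool" where
  "simple_graph \<Gamma> \<longleftrightarrow>
     finite (verts \<Gamma>) \<and> (\<forall>e\<in>edges \<Gamma>. e \<subseteq> verts \<Gamma> \<and> card e = 2)"

definition independent_set :: "'a graph \<Rightarrow> 'a set \<Rightarrow> bool" where
  "independent_set \<Gamma> I \<longleftrightarrow>
     I \<subseteq> verts \<Gamma> \<and> (\<forall>u\<in>I. \<forall>v\<in>I. {u, v} \<notin> edges \<Gamma>)"

definition induced_graph :: "'a graph \<Rightarrow> 'a set \<Rightarrow> 'a graph" where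
  "induced_graph \<Gamma> S =
     \<lparr>verts = verts \<Gamma> \<inter> S, edges = {e \<in> edges \<Gamma>. e \<subseteq> S}\<rparr>"

record 'a ec_graph =
  underlying :: "'a graph"
  red :: "'a set set"
  blue :: "'a set set"

definition two_edge_coloured_graph :: "'a ec_graph \<Rightarrow> bool" where
  "two_edge_coloured_graph G \<longleftrightarrow>
     simple_graph (underlying G) \<and>
     red G \<subseteq> edges (underlying G) \<and> blue G \<subseteq> edges (underlying G) \<and>
     red G \<inter> blue G = {} \<and> red G \<union> blue G = edges (underlying G)"

definition induced_ec_graph :: "'a ec_graph \<Rightarrow> 'a set \<Rightarrow> 'a ec_graph" where
  "induced_ec_graph G S =
     \<lparr>underlying = induced_graph (underlying G) S,
      red = red G \<inter> edges (induced_graph (underlying G) S),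
      blue = blue G \<inter> edges (induced_graph (underlying G) S)\<rparr>"

definition monochromatic :: "'a ec_graph \<Rightarrow> bool" where
  "monochromatic G \<longleftrightarrow> red G = {} \<or> blue G = {}"


section \<open>Vertex colourings\<close>

text \<open>Colourings are extensional functions (undefined outside the vertex set),
  so that each one is counted exactly once.\<close>

definition proper_colourings :: "'a graph \<Rightarrow> nat \<Rightarrow> ('a \<Rightarrow> nat) set" where
  "proper_colourings \<Gamma> k =
     {c \<in> verts \<Gamma> \<rightarrow>\<^sub>E {1..k}. \<forall>u v. {u, v} \<in> edges \<Gamma> \<longrightarrow> c u \<noteq> c v}"

text \<open>The quantifiers range over all ordered representations of a red edge
  \<open>{u, x}\<close> and a blue edge \<open>{v, y}\<close>, so either endpoint plays
  the role of \<open>u\<close>, respectively \<open>v\<close>.\<close>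

definition ec_colourings :: "'a ec_graph \<Rightarrow> nat \<Rightarrow> ('a \<Rightarrow> nat) set" where
  "ec_colourings G k =
     {c \<in> proper_colourings (underlying G) k.
        \<forall>u x v y. {u, x} \<in> red G \<and> {v, y} \<in> blue G \<longrightarrow> c u = c v \<longrightarrow> c x \<noteq> c y}"


section \<open>Chromatic polynomials\<close>

text \<open>Existence and uniqueness of the polynomials described below are the theorems
  \<open>ex1_chromatic_polynomial\<close> and \<open>ex1_ec_chromatic_polynomial\<close>.\<close>

definition chromatic_polynomial :: "'a graph \<Rightarrow> real poly" where
  "chromatic_polynomial \<Gamma> =
     (THE p. \<forall>k::nat. poly p (real k) = real (card (proper_colourings \<Gamma> k)))"

definition ec_chromatic_polynomial :: "'a ec_graph \<Rightarrow> real poly" where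
  "ec_chromatic_polynomial G =
     (THE p. \<forall>k::nat. poly p (real k) = real (card (ec_colourings G k)))"

definition chromatically_invariant :: "'a ec_graph \<Rightarrow> bool" where
  "chromatically_invariant G \<longleftrightarrow>
     ec_chromatic_polynomial G = chromatic_polynomial (underlying G)"


section \<open>The chromatic polynomials are well defined\<close>

lemma poly_eq_if_eq_on_nat:
  fixes p q :: "real poly"
  assumes "\<And>k::nat. poly p (real k) = poly q (real k)"
  shows "p = q"
proof (rule ccontr)
  assume "p \<noteq> q"
  then have "finite {x. poly (p - q) x = 0}"
    by (intro poly_roots_finite) simp
  moreover have "range real \<subseteq> {x. poly (p - q) x = 0}"
    using assms by auto
  ultimately have "finite (range real)"
    by (rule rev_finite_subset)
  then show False
    by (meson finite_imageD inj_of_nat infinite_UNIV_nat)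
qed

lemma card_maps_onto_eq:
  fixes V :: "'a set" and Q :: "('a \<Rightarrow> nat) \<Rightarrow> bool"
  assumes inv: "\<And>c d. (\<And>u v. u \<in> V \<Longrightarrow> v \<in> V \<Longrightarrow> c u = c v \<longleftrightarrow> d u = d v) \<Longrightarrow> Q c \<Longrightarrow> Q d"
    and "finite A" "finite A'" "card A = card A'"
  shows "card {c \<in> extensional V. c ` V = A \<and> Q c} =
         card {c \<in> extensional V. c ` V = A' \<and> Q c}"
proof -
  obtain f where f: "bij_betw f A A'"
    using assms finite_same_card_bij by blast
  define g where "g = inv_into A f"
  have g: "bij_betw g A' A" and gf: "\<And>a. a \<in> A \<Longrightarrow> g (f a) = a"
    and fg: "\<And>a. a \<in> A' \<Longrightarrow> f (g a) = a"
    using f unfolding g_def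
    by (auto simp: bij_betw_inv_into bij_betw_inv_into_left bij_betw_inv_into_right)
  have step: "restrict (h \<circ> c) V \<in> {c \<in> extensional V. c ` V = Y \<and> Q c}"
    if h: "bij_betw h X Y" and c: "c \<in> {c \<in> extensional V. c ` V = X \<and> Q c}"
    for h c X Y
  proof -
    have "restrict (h \<circ> c) V ` V = h ` (c ` V)"
      by auto
    then have "restrict (h \<circ> c) V ` V = Y"
      using h c by (simp add: bij_betw_def)
    moreover have "Q (restrict (h \<circ> c) V)"
    proof (rule inv)
      show "Q c" using c by simp
      show "c u = c v \<longleftrightarrow> restrict (h \<circ> c) V u = restrict (h \<circ> c) V v"
        if "u \<in> V" "v \<in> V" for u v
        using that c h by (auto simp: bij_betw_def inj_on_def)
    qed
    ultimately show ?thesis by simp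
  qed
  have inverse: "restrict (h' \<circ> restrict (h \<circ> c) V) V = c"
    if "\<And>a. a \<in> X \<Longrightarrow> h' (h a) = a" "c \<in> extensional V" "c ` V = X"
    for h h' :: "nat \<Rightarrow> nat" and c X
  proof (rule ext)
    fix u
    show "restrict (h' \<circ> restrict (h \<circ> c) V) V u = c u"
    proof (cases "u \<in> V")
      case True
      then have "c u \<in> X"
        using that(3) by blast
      then show ?thesis
        using True that(1) by simp
    next
      case False
      then show ?thesis
        by (simp add: extensional_arb[OF that(2) False])
    qed
  qed
  have "bij_betw (\<lambda>c. restrict (f \<circ> c) V)
      {c \<in> extensional V. c ` V = A \<and> Q c} {c \<in> extensional V. c ` V = A' \<and> Q c}"
  proof (rule bij_betw_byWitness[where f' = "\<lambda>c. restrict (g \<circ> c) V"])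
    show "\<forall>c\<in>{c \<in> extensional V. c ` V = A \<and> Q c}.
        restrict (g \<circ> restrict (f \<circ> c) V) V = c"
      by (intro ballI inverse[where X = A] gf) auto
    show "\<forall>c\<in>{c \<in> extensional V. c ` V = A' \<and> Q c}.
        restrict (f \<circ> restrict (g \<circ> c) V) V = c"
      by (intro ballI inverse[where X = A'] fg) auto
  qed (intro image_subsetI step[OF f] step[OF g]; assumption)+
  then show ?thesis
    by (rule bij_betw_same_card)
qed

lemma ex1_counting_polynomial:
  fixes V :: "'a set" and Q :: "('a \<Rightarrow> nat) \<Rightarrow> bool"
  assumes "finite V"
    and inv: "\<And>c d. (\<And>u v. u \<in> V \<Longrightarrow> v \<in> V \<Longrightarrow> c u = c v \<longleftrightarrow> d u = d v) \<Longrightarrow> Q c \<Longrightarrow> Q d"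
  shows "\<exists>!p::real poly. \<forall>k::nat. poly p (real k) = real (card {c \<in> V \<rightarrow>\<^sub>E {1..k}. Q c})"
proof -
  define M where "M A = {c \<in> extensional V. c ` V = A \<and> Q c}" for A
  define a where "a j = card (M {1..j})" for j
  have card_M: "card (M A) = a (card A)" if "finite A" for A
    unfolding a_def M_def using that by (intro card_maps_onto_eq) (auto intro: inv)
  have a_0: "a j = 0" if "j > card V" for j
  proof -
    have "c ` V \<noteq> {1..j}" for c
      using that card_image_le[OF \<open>finite V\<close>, of c]
      by (metis card_atLeastAtMost diff_Suc_1 linorder_not_less)
    then have "M {1..j} = {}"
      by (auto simp: M_def)
    then show ?thesis by (simp add: a_def)
  qed
  have count: "card {c \<in> V \<rightarrow>\<^sub>E {1..k}. Q c} = (\<Sum>j\<le>card V. (k choose j) * a j)" for k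
  proof -
    have fin: "finite (M A)" if "A \<in> Pow {1..k}" for A
    proof (rule finite_subset)
      show "M A \<subseteq> V \<rightarrow>\<^sub>E {1..k}" using that by (auto simp: M_def PiE_def)
      show "finite (V \<rightarrow>\<^sub>E {1..k})" using \<open>finite V\<close> by (simp add: finite_PiE)
    qed
    have "{c \<in> V \<rightarrow>\<^sub>E {1..k}. Q c} = (\<Union>A\<in>Pow {1..k}. M A)"
      by (auto simp: M_def PiE_def)
    then have "card {c \<in> V \<rightarrow>\<^sub>E {1..k}. Q c} = (\<Sum>A\<in>Pow {1..k}. card (M A))"
      using fin by (simp only:) (rule card_UN_disjoint, auto simp: M_def)
    also have "\<dots> = (\<Sum>A\<in>Pow {1..k}. a (card A))"
      by (intro sum.cong refl card_M) (auto intro: finite_subset)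
    also have "\<dots> = (\<Sum>j\<le>k. \<Sum>A\<in>{A \<in> Pow {1..k}. card A = j}. a (card A))"
      by (rule sum.group[symmetric]) (auto dest: card_mono[rotated])
    also have "\<dots> = (\<Sum>j\<le>k. (k choose j) * a j)"
      by (intro sum.cong refl) (simp add: n_subsets)
    also have "\<dots> = (\<Sum>j\<le>max k (card V). (k choose j) * a j)"
      by (rule sum.mono_neutral_left) auto
    also have "\<dots> = (\<Sum>j\<le>card V. (k choose j) * a j)"
      by (rule sum.mono_neutral_right) (auto simp: a_0)
    finally show ?thesis .
  qed
  define p :: "real poly" where
    "p = (\<Sum>j\<le>card V. smult (real (a j) / fact j) (\<Prod>i = 0..<j. [:- real i, 1:]))"
  have "poly p (real k) = real (card {c \<in> V \<rightarrow>\<^sub>E {1..k}. Q c})" for k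
    unfolding count p_def
    by (simp add: poly_sum poly_prod binomial_gbinomial gbinomial_prod_rev mult.commute)
  then show ?thesis
    by (intro ex1I[of _ p]) (auto intro: poly_eq_if_eq_on_nat)
qed

lemma simple_graph_edge_verts:
  assumes "simple_graph \<Gamma>" "{u, v} \<in> edges \<Gamma>"
  shows "u \<in> verts \<Gamma>" "v \<in> verts \<Gamma>"
proof -
  have "{u, v} \<subseteq> verts \<Gamma>"
    using assms unfolding simple_graph_def by meson
  then show "u \<in> verts \<Gamma>" "v \<in> verts \<Gamma>"
    by simp_all
qed

theorem ex1_chromatic_polynomial:
  assumes "simple_graph \<Gamma>"
  shows "\<exists>!p::real poly. \<forall>k::nat. poly p (real k) = real (card (proper_colourings \<Gamma> k))"
  unfolding proper_colourings_def
proof (rule ex1_counting_polynomial)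
  show "finite (verts \<Gamma>)"
    using assms by (simp add: simple_graph_def)
next
  fix c d :: "'a \<Rightarrow> nat"
  assume cd: "\<And>u v. u \<in> verts \<Gamma> \<Longrightarrow> v \<in> verts \<Gamma> \<Longrightarrow> c u = c v \<longleftrightarrow> d u = d v"
    and c: "\<forall>u v. {u, v} \<in> edges \<Gamma> \<longrightarrow> c u \<noteq> c v"
  show "\<forall>u v. {u, v} \<in> edges \<Gamma> \<longrightarrow> d u \<noteq> d v"
  proof (intro allI impI)
    fix u v
    assume e: "{u, v} \<in> edges \<Gamma>"
    then have "c u \<noteq> c v"
      using c by simp
    then show "d u \<noteq> d v"
      using cd[OF simple_graph_edge_verts[OF assms e]] by simp
  qed
qed

theorem ex1_ec_chromatic_polynomial:
  assumes "two_edge_coloured_graph G"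
  shows "\<exists>!p::real poly. \<forall>k::nat. poly p (real k) = real (card (ec_colourings G k))"
proof -
  let ?\<Gamma> = "underlying G"
  define Q where "Q c \<longleftrightarrow> (\<forall>u v. {u, v} \<in> edges ?\<Gamma> \<longrightarrow> c u \<noteq> c v) \<and>
    (\<forall>u x v y. {u, x} \<in> red G \<and> {v, y} \<in> blue G \<longrightarrow> c u = c v \<longrightarrow> c x \<noteq> c y)"
    for c :: "'a \<Rightarrow> nat"
  have eq: "ec_colourings G k = {c \<in> verts ?\<Gamma> \<rightarrow>\<^sub>E {1..k}. Q c}" for k
    unfolding ec_colourings_def proper_colourings_def Q_def by (simp add: conj_assoc)
  have sg: "simple_graph ?\<Gamma>" and rb: "red G \<subseteq> edges ?\<Gamma>" "blue G \<subseteq> edges ?\<Gamma>"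
    using assms by (simp_all add: two_edge_coloured_graph_def)
  show ?thesis
    unfolding eq
  proof (rule ex1_counting_polynomial)
    show "finite (verts ?\<Gamma>)"
      using sg by (simp add: simple_graph_def)
  next
    fix c d :: "'a \<Rightarrow> nat"
    assume cd: "\<And>u v. u \<in> verts ?\<Gamma> \<Longrightarrow> v \<in> verts ?\<Gamma> \<Longrightarrow> c u = c v \<longleftrightarrow> d u = d v"
      and Q: "Q c"
    have "d u \<noteq> d v" if e: "{u, v} \<in> edges ?\<Gamma>" for u v
    proof -
      have "c u \<noteq> c v"
        using Q e by (simp add: Q_def)
      then show ?thesis
        using cd[OF simple_graph_edge_verts[OF sg e]] by simp
    qed
    moreover have "d x \<noteq> d y"
      if e: "{u, x} \<in> red G" "{v, y} \<in> blue G" and eq: "d u = d v" for u x v y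
    proof -
      note ux = simple_graph_edge_verts[OF sg subsetD[OF rb(1) e(1)]]
      note vy = simple_graph_edge_verts[OF sg subsetD[OF rb(2) e(2)]]
      have "c u = c v"
        using cd[OF ux(1) vy(1)] eq by simp
      moreover have "c u = c v \<longrightarrow> c x \<noteq> c y"
        using Q e unfolding Q_def by iprover
      ultimately show ?thesis
        using cd[OF ux(2) vy(2)] by simp
    qed
    ultimately show "Q d"
      unfolding Q_def by iprover
  qed
qed

end

theory Submission
  imports Defs
begin

text \<open>Every colouring of \<open>G\<close> is a proper colouring of \<open>\<Gamma>\<close>, so the two polynomials agree iff the
  two sets of \<open>k\<close>-colourings agree for every \<open>k\<close>. A proper colouring that is not a colouring of
  \<open>G\<close> has a red and a blue edge joining the same two colour classes, and these classes are disjoint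
  independent sets. Conversely, if a red and a blue edge join \<open>I1\<close> and \<open>I2\<close>, then giving each of
  \<open>I1\<close> and \<open>I2\<close> a single colour and all other vertices pairwise different new colours yields a
  proper colouring that is not a colouring of \<open>G\<close>.\<close>

lemma finite_proper_colourings:
  assumes "simple_graph \<Gamma>"
  shows "finite (proper_colourings \<Gamma> k)"
proof (rule finite_subset)
  show "proper_colourings \<Gamma> k \<subseteq> verts \<Gamma> \<rightarrow>\<^sub>E {1..k}"
    by (auto simp: proper_colourings_def)
  show "finite (verts \<Gamma> \<rightarrow>\<^sub>E {1..k})"
    using assms by (simp add: simple_graph_def finite_PiE)
qed

text \<open>Two real polynomials that agree at all naturals are equal, so invariance means that the
  two counts agree for every \<open>k\<close>. One set of colourings contains the other and both are
  finite, so equal counts force equal sets.\<close>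

lemma chromatically_invariant_iff_colourings_eq:
  assumes "two_edge_coloured_graph G"
  shows "chromatically_invariant G \<longleftrightarrow>
    (\<forall>k. ec_colourings G k = proper_colourings (underlying G) k)"
proof -
  let ?\<Gamma> = "underlying G"
  have sg: "simple_graph ?\<Gamma>"
    using assms by (simp add: two_edge_coloured_graph_def)
  have P: "poly (chromatic_polynomial ?\<Gamma>) (real k) = real (card (proper_colourings ?\<Gamma> k))" for k
    using theI'[OF ex1_chromatic_polynomial[OF sg]] unfolding chromatic_polynomial_def by blast
  have E: "poly (ec_chromatic_polynomial G) (real k) = real (card (ec_colourings G k))" for k
    using theI'[OF ex1_ec_chromatic_polynomial[OF assms]]
    unfolding ec_chromatic_polynomial_def by blast
  have "ec_colourings G k \<subseteq> proper_colourings ?\<Gamma> k" for k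
    by (auto simp: ec_colourings_def)
  then have "card (ec_colourings G k) = card (proper_colourings ?\<Gamma> k) \<longleftrightarrow>
      ec_colourings G k = proper_colourings ?\<Gamma> k" for k
    using card_subset_eq[OF finite_proper_colourings[OF sg], of "ec_colourings G k" k] by auto
  moreover have "chromatically_invariant G \<longleftrightarrow>
      (\<forall>k. card (ec_colourings G k) = card (proper_colourings ?\<Gamma> k))"
  proof
    assume "chromatically_invariant G"
    then show "\<forall>k. card (ec_colourings G k) = card (proper_colourings ?\<Gamma> k)"
      using E P by (simp add: chromatically_invariant_def)
  next
    assume "\<forall>k. card (ec_colourings G k) = card (proper_colourings ?\<Gamma> k)"
    then show "chromatically_invariant G"
      unfolding chromatically_invariant_def by (intro poly_eq_if_eq_on_nat) (simp add: E P)
  qed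
  ultimately show ?thesis by simp
qed

lemma proper_colourings_edge:
  assumes "c \<in> proper_colourings \<Gamma> k" "{u, v} \<in> edges \<Gamma>"
  shows "c u \<noteq> c v"
  using assms by (simp add: proper_colourings_def)

lemma independent_set_colour_class:
  assumes "c \<in> proper_colourings \<Gamma> k"
  shows "independent_set \<Gamma> {w \<in> verts \<Gamma>. c w = i}"
  unfolding independent_set_def
proof (intro conjI ballI)
  fix u v
  assume "u \<in> {w \<in> verts \<Gamma>. c w = i}" "v \<in> {w \<in> verts \<Gamma>. c w = i}"
  then show "{u, v} \<notin> edges \<Gamma>"
    using proper_colourings_edge[OF assms, of u v] by auto
qed simp

text \<open>Neither set can contain both endpoints. Orienting every edge from \<open>I\<close> to
  \<open>J\<close> lets a red and a blue edge be compared endpoint by endpoint.\<close>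

lemma edge_between_independent_sets:
  assumes "simple_graph \<Gamma>" "independent_set \<Gamma> I" "independent_set \<Gamma> J"
    and "e \<in> edges \<Gamma>" "e \<subseteq> I \<union> J"
  obtains u x where "e = {u, x}" "u \<in> I" "x \<in> J"
proof -
  have "card e = 2"
    using assms by (simp add: simple_graph_def)
  then obtain u x where e: "e = {u, x}"
    by (auto simp: card_2_iff)
  with assms have "u \<in> I \<and> x \<in> J \<or> x \<in> I \<and> u \<in> J"
    unfolding independent_set_def by auto
  with e that show thesis
    by (auto simp: insert_commute)
qed

lemma proper_colouring_constant_on_independent_sets:
  assumes sg: "simple_graph \<Gamma>" and I: "independent_set \<Gamma> I" and J: "independent_set \<Gamma> J"
    and "I \<inter> J = {}"
  obtains k c i j where "c \<in> proper_colourings \<Gamma> k"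
    "\<And>u. u \<in> I \<Longrightarrow> c u = i" "\<And>x. x \<in> J \<Longrightarrow> c x = j"
proof -
  \<comment> \<open>The injective numbering \<open>f\<close> of the vertices supplies the pairwise
    different colours.\<close>
  obtain n and f :: "'a \<Rightarrow> nat" where f: "f ` verts \<Gamma> = {m. m < n}" "inj_on f (verts \<Gamma>)"
    using finite_imp_inj_to_nat_seg[of "verts \<Gamma>"] sg unfolding simple_graph_def by blast
  \<comment> \<open>Colours 1 and 2 are reserved for \<open>I\<close> and \<open>J\<close>; the
    shift by 3 keeps all other vertices off them.\<close>
  define c where "c = restrict (\<lambda>w. if w \<in> I then 1 else if w \<in> J then 2 else f w + 3) (verts \<Gamma>)"
  have sub: "I \<subseteq> verts \<Gamma>" "J \<subseteq> verts \<Gamma>"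
    using I J by (simp_all add: independent_set_def)
  have "c u \<noteq> c v" if e: "{u, v} \<in> edges \<Gamma>" for u v
  proof -
    have uv: "u \<in> verts \<Gamma>" "v \<in> verts \<Gamma>"
      using simple_graph_edge_verts[OF sg e] .
    have "card {u, v} = 2"
      using sg e unfolding simple_graph_def by blast
    then have "u \<noteq> v" by auto
    then have "f u \<noteq> f v"
      using f(2) uv by (auto dest: inj_onD)
    \<comment> \<open>Two distinct vertices share a colour under \<open>c\<close> only if both lie
      in \<open>I\<close> or both lie in \<open>J\<close>, and no edge does that.\<close>
    moreover have "\<not> (u \<in> I \<and> v \<in> I)" "\<not> (u \<in> J \<and> v \<in> J)"
      using I J e by (auto simp: independent_set_def)
    ultimately show ?thesis
      using uv by (auto simp: c_def)
  qed
  \<comment> \<open>The values of \<open>f\<close> are below \<open>n\<close>, so the largest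
    shifted colour is at most \<open>(n - 1) + 3\<close>.\<close>
  moreover have "c \<in> verts \<Gamma> \<rightarrow>\<^sub>E {1..n + 2}"
  proof -
    have "f w < n" if "w \<in> verts \<Gamma>" for w
      using f(1) that by blast
    then show ?thesis
      by (auto simp: c_def intro!: Suc_leI)
  qed
  ultimately have "c \<in> proper_colourings \<Gamma> (n + 2)"
    by (simp add: proper_colourings_def)
  moreover have "c u = 1" if "u \<in> I" for u
    using that sub by (auto simp: c_def)
  moreover have "c x = 2" if "x \<in> J" for x
    using that sub \<open>I \<inter> J = {}\<close> by (auto simp: c_def)
  ultimately show thesis
    by (rule that)
qed

theorem theorem8:
  fixes G :: "'a ec_graph"
  assumes "two_edge_coloured_graph G"
  shows "chromatically_invariant G \<longleftrightarrow>
    (\<forall>I1 I2. independent_set (underlying G) I1 \<and> independent_set (underlying G) I2 \<and>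
        I1 \<noteq> {} \<and> I2 \<noteq> {} \<and> I1 \<inter> I2 = {} \<longrightarrow>
        monochromatic (induced_ec_graph G (I1 \<union> I2)))"
    (is "_ \<longleftrightarrow> ?M")
proof -
  let ?\<Gamma> = "underlying G"
  have sg: "simple_graph ?\<Gamma>" and red: "red G \<subseteq> edges ?\<Gamma>" and blue: "blue G \<subseteq> edges ?\<Gamma>"
    using assms by (simp_all add: two_edge_coloured_graph_def)
  \<comment> \<open>In this form, a failure of monochromaticity directly yields one edge of each
    colour inside \<open>S\<close>.\<close>
  have mono: "monochromatic (induced_ec_graph G S) \<longleftrightarrow>
      \<not> ((\<exists>e\<in>red G. e \<subseteq> S) \<and> (\<exists>e\<in>blue G. e \<subseteq> S))" for S
    using red blue by (auto simp: monochromatic_def induced_ec_graph_def induced_graph_def)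
  have only_if: "?M" if eq: "\<forall>k. ec_colourings G k = proper_colourings ?\<Gamma> k"
  proof (intro allI impI, rule ccontr)
    fix I J
    assume IJ: "independent_set ?\<Gamma> I \<and> independent_set ?\<Gamma> J \<and> I \<noteq> {} \<and> J \<noteq> {} \<and> I \<inter> J = {}"
      and "\<not> monochromatic (induced_ec_graph G (I \<union> J))"
    then obtain e e' where e: "e \<in> red G" "e \<subseteq> I \<union> J" "e' \<in> blue G" "e' \<subseteq> I \<union> J"
      unfolding mono by blast
    obtain u x where ux: "e = {u, x}" "u \<in> I" "x \<in> J"
      using edge_between_independent_sets[OF sg _ _ subsetD[OF red e(1)] e(2)] IJ by blast
    obtain v y where vy: "e' = {v, y}" "v \<in> I" "y \<in> J"
      using edge_between_independent_sets[OF sg _ _ subsetD[OF blue e(3)] e(4)] IJ by blast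
    obtain k c i j where c: "c \<in> proper_colourings ?\<Gamma> k"
      "\<And>u. u \<in> I \<Longrightarrow> c u = i" "\<And>x. x \<in> J \<Longrightarrow> c x = j"
      by (rule proper_colouring_constant_on_independent_sets[OF sg, of I J]) (use IJ in auto)
    have "c \<in> ec_colourings G k"
      using c(1) eq by simp
    then have "{u, x} \<in> red G \<and> {v, y} \<in> blue G \<longrightarrow> c u = c v \<longrightarrow> c x \<noteq> c y"
      unfolding ec_colourings_def mem_Collect_eq by iprover
    \<comment> \<open>Both edges run from \<open>I\<close> to \<open>J\<close>, so
      \<open>c u = i = c v\<close> and \<open>c x = j = c y\<close>.\<close>
    then show False
      using c(2,3) e ux vy by simp
  qed
  have ec: "c \<in> ec_colourings G k" if M: "?M" and c: "c \<in> proper_colourings ?\<Gamma> k" for c k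
  proof -
    have "c x \<noteq> c y" if e: "{u, x} \<in> red G" "{v, y} \<in> blue G" and uv: "c u = c v" for u x v y
    proof
      assume xy: "c x = c y"
      \<comment> \<open>The independent sets to test are the colour classes of the two ends of the
        red edge; they are disjoint because \<open>c\<close> is proper.\<close>
      let ?I = "\<lambda>i. {w \<in> verts ?\<Gamma>. c w = i}"
      have ux: "u \<in> verts ?\<Gamma>" "x \<in> verts ?\<Gamma>" and vy: "v \<in> verts ?\<Gamma>" "y \<in> verts ?\<Gamma>"
        using simple_graph_edge_verts[OF sg subsetD[OF red e(1)]]
          simple_graph_edge_verts[OF sg subsetD[OF blue e(2)]] by simp_all
      have "c u \<noteq> c x"
        by (rule proper_colourings_edge[OF c subsetD[OF red e(1)]])
      then have "?I (c u) \<noteq> {}" "?I (c x) \<noteq> {}" "?I (c u) \<inter> ?I (c x) = {}"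
        using ux by auto
      then have "monochromatic (induced_ec_graph G (?I (c u) \<union> ?I (c x)))"
        using M[rule_format, of "?I (c u)" "?I (c x)"] independent_set_colour_class[OF c]
        by simp
      \<comment> \<open>The blue edge lies in the same union because \<open>v\<close> has the colour
        of \<open>u\<close> and \<open>y\<close> has the colour of \<open>x\<close>.\<close>
      moreover have "{u, x} \<subseteq> ?I (c u) \<union> ?I (c x)" "{v, y} \<subseteq> ?I (c u) \<union> ?I (c x)"
        using ux vy uv xy by auto
      ultimately show False
        unfolding mono using e by blast
    qed
    with c show ?thesis
      unfolding ec_colourings_def mem_Collect_eq by iprover
  qed
  have if_mono: "ec_colourings G k = proper_colourings ?\<Gamma> k" if M: "?M" for k
  proof
    show "ec_colourings G k \<subseteq> proper_colourings ?\<Gamma> k"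
      by (auto simp: ec_colourings_def)
    show "proper_colourings ?\<Gamma> k \<subseteq> ec_colourings G k"
      using ec[OF M] by (rule subsetI)
  qed
  show ?thesis
    unfolding chromatically_invariant_iff_colourings_eq[OF assms]
  proof (rule iffI)
    assume "\<forall>k. ec_colourings G k = proper_colourings ?\<Gamma> k"
    then show "?M" by (rule only_if)
  next
    assume M: "?M"
    show "\<forall>k. ec_colourings G k = proper_colourings ?\<Gamma> k"
      by (rule allI) (rule if_mono[OF M])
  qed
qed

end
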